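(* Let $n\ge2$, $B=M_n(\mathbb{C})$, let $h_0$ be (the density of) an extreme point of $\Gamma$, the convex set of marginal tracial states on $B\otimes B$, and let $R$ be the range projection of $h_0$. Then $h_0$ is a pure state on $B\otimes B$ if and only if $(I-(P-Q)^2)\big(R(B\otimes B)R\big)\subset R(B\otimes B)R$.
   Context: $\tau$ denotes the unique tracial state (normalized trace, $\tau(I)=1$) on $B\otimes B\cong M_{n^2}(\mathbb{C})$, and $\tau_B$ the normalized trace on $B$. States on $B\otimes B$ are identified with positive elements $h\in B\otimes B$ with $\tau(h)=1$ via $\phi(a)=\tau(ah)$; a state is pure if it is an extreme point of the set of all states on $B\otimes B$. A state $\phi$ is a marginal tracial state if $\phi(x\otimes I)=\phi(I\otimes x)=\tau_B(x)$ for all $x\in B$. $P$ (resp. $Q$) is the canonical trace-preserving conditional expectation of $B\otimes B$ onto $B\otimes I$ (resp. $I\otimes B$), i.e. the linear map with $P(x\otimes y)=\tau_B(y)\,x\otimes I$ (resp. $Q(x\otimes y)=\tau_B(x)\,I\otimes y$). In $I-(P-Q)^2$, $I$ is the identity map on $B\otimes B$ and the square is composition of linear maps on $B\otimes B$. The range projection of $h_0$ is the orthogonal projection in $B\otimes B$ onto the range of $h_0$. *)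

theory Defs
  imports "HOL-Analysis.Analysis"
begin

text \<open>
  The algebra of n by n complex matrices is \<^typ>\<open>complex^'n^'n\<close>. The tensor product of this
  algebra with itself is realised as the algebra of matrices indexed by pairs, the elementary
  tensors being Kronecker products.
\<close>

type_synonym 'n cmat = "((complex, 'n) vec, 'n) vec"

definition madj :: "'m::finite cmat \<Rightarrow> 'm cmat"
  where "madj a = (\<chi> i j. cnj (a $ j $ i))"

definition tensor :: "'n::finite cmat \<Rightarrow> 'n cmat \<Rightarrow> ('n \<times> 'n) cmat"  (infixr "\<otimes>\<^sub>m" 75)
  where "x \<otimes>\<^sub>m y = (\<chi> p q. x $ fst p $ fst q * y $ snd p $ snd q)"

definition ntrace :: "'m::finite cmat \<Rightarrow> complex"
  where "ntrace a = trace a / of_nat CARD('m)"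

text \<open>
  Positivity: every value of the sesquilinear form of the matrix on the diagonal is a nonnegative
  real number. Over the complex numbers this forces the matrix to be self-adjoint.
\<close>

definition positive_mat :: "'m::finite cmat \<Rightarrow> bool"
  where "positive_mat a \<longleftrightarrow> (\<forall>v. (\<Sum>i\<in>UNIV. cnj (v $ i) * (a *v v) $ i) \<in> \<real>\<^sub>\<ge>\<^sub>0)"

text \<open>
  States are identified with their densities with respect to the normalised trace;
  \<^term>\<open>functional_of\<close> recovers the functional. The identification is affine, so extreme
  points may be taken among densities.
\<close>

definition functional_of :: "'m::finite cmat \<Rightarrow> 'm cmat \<Rightarrow> complex"
  where "functional_of h a = ntrace (a ** h)"

definition states :: "('m::finite cmat) set"
  where "states = {h. positive_mat h \<and> ntrace h = 1}"

definition pure_state :: "'m::finite cmat \<Rightarrow> bool"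
  where "pure_state h \<longleftrightarrow> h extreme_point_of states"

definition marginal_tracial_states :: "(('n::finite \<times> 'n) cmat) set"
  where "marginal_tracial_states =
    {h \<in> states. \<forall>x. functional_of h (x \<otimes>\<^sub>m mat 1) = ntrace x \<and>
                     functional_of h (mat 1 \<otimes>\<^sub>m x) = ntrace x}"

text \<open>
  The trace-preserving conditional expectations onto the two tensor factors, written as
  normalised partial traces. The lemmas below show that they are the linear maps determined by
  the usual formulas on elementary tensors.
\<close>

definition cond_exp_left :: "('n::finite \<times> 'n) cmat \<Rightarrow> ('n \<times> 'n) cmat"
  where "cond_exp_left a =
    (\<chi> i j. (\<Sum>k\<in>UNIV. a $ (i, k) $ (j, k)) / of_nat CARD('n)) \<otimes>\<^sub>m mat 1"

definition cond_exp_right :: "('n::finite \<times> 'n) cmat \<Rightarrow> ('n \<times> 'n) cmat"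
  where "cond_exp_right a =
    mat 1 \<otimes>\<^sub>m (\<chi> k l. (\<Sum>i\<in>UNIV. a $ (i, k) $ (i, l)) / of_nat CARD('n))"

definition cond_exp_diff :: "('n::finite \<times> 'n) cmat \<Rightarrow> ('n \<times> 'n) cmat"
  where "cond_exp_diff a = cond_exp_left a - cond_exp_right a"

definition is_range_projection :: "'m::finite cmat \<Rightarrow> 'm cmat \<Rightarrow> bool"
  where "is_range_projection p h \<longleftrightarrow>
    p ** p = p \<and> madj p = p \<and> range (\<lambda>v. p *v v) = range (\<lambda>v. h *v v)"

definition corner :: "'m::finite cmat \<Rightarrow> ('m cmat) set"
  where "corner p = {p ** a ** p | a. True}"

definition cscale :: "complex \<Rightarrow> 'm::finite cmat \<Rightarrow> 'm cmat"
  where "cscale c a = (\<chi> i j. c * a $ i $ j)"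

lemma cond_exp_left_tensor:
  "cond_exp_left (x \<otimes>\<^sub>m y) = cscale (ntrace y) (x \<otimes>\<^sub>m mat 1)"
  by (simp add: cond_exp_left_def tensor_def cscale_def ntrace_def trace_def vec_eq_iff
      sum_distrib_left[symmetric])

lemma cond_exp_right_tensor:
  "cond_exp_right (x \<otimes>\<^sub>m y) = cscale (ntrace x) (mat 1 \<otimes>\<^sub>m y)"
  by (simp add: cond_exp_right_def tensor_def cscale_def ntrace_def trace_def vec_eq_iff
      sum_distrib_right[symmetric])

lemma cond_exp_left_linear:
  "cond_exp_left (a + b) = cond_exp_left a + cond_exp_left b"
  "cond_exp_left (cscale c a) = cscale c (cond_exp_left a)"
  by (simp_all add: cond_exp_left_def tensor_def cscale_def vec_eq_iff sum.distrib
      sum_distrib_left[symmetric] add_divide_distrib distrib_right)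

lemma cond_exp_right_linear:
  "cond_exp_right (a + b) = cond_exp_right a + cond_exp_right b"
  "cond_exp_right (cscale c a) = cscale c (cond_exp_right a)"
  by (simp_all add: cond_exp_right_def tensor_def cscale_def vec_eq_iff sum.distrib
      sum_distrib_left[symmetric] add_divide_distrib distrib_left)

definition munit :: "'n::finite \<Rightarrow> 'n \<Rightarrow> 'n cmat"
  where "munit k l = (\<chi> i j. if i = k \<and> j = l then 1 else 0)"

lemma tensor_decomposition:
  "a = (\<Sum>p\<in>UNIV. \<Sum>q\<in>UNIV. cscale (a $ p $ q) (munit (fst p) (fst q) \<otimes>\<^sub>m munit (snd p) (snd q)))"
proof -
  have "(\<Sum>p\<in>UNIV. \<Sum>q\<in>UNIV.
      cscale (a $ p $ q) (munit (fst p) (fst q) \<otimes>\<^sub>m munit (snd p) (snd q))) $ r $ s = a $ r $ s" for r s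
  proof -
    have "(\<Sum>p\<in>UNIV. \<Sum>q\<in>UNIV.
        cscale (a $ p $ q) (munit (fst p) (fst q) \<otimes>\<^sub>m munit (snd p) (snd q))) $ r $ s
      = (\<Sum>p\<in>UNIV. \<Sum>q\<in>UNIV. if p = r then (if q = s then a $ p $ q else 0) else 0)"
      by (auto simp: cscale_def tensor_def munit_def prod_eq_iff intro!: sum.cong)
    also have "\<dots> = (\<Sum>p\<in>UNIV. if p = r then a $ p $ s else 0)"
      by (intro sum.cong) auto
    finally show ?thesis by simp
  qed
  then show ?thesis by (simp add: vec_eq_iff)
qed

lemma linear_determined_by_tensors:
  fixes f g :: "('n::finite \<times> 'n) cmat \<Rightarrow> ('n \<times> 'n) cmat"
  assumes "\<And>a b. f (a + b) = f a + f b" "\<And>c a. f (cscale c a) = cscale c (f a)"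
    and "\<And>a b. g (a + b) = g a + g b" "\<And>c a. g (cscale c a) = cscale c (g a)"
    and "\<And>x y. f (x \<otimes>\<^sub>m y) = g (x \<otimes>\<^sub>m y)"
  shows "f = g"
proof
  fix a :: "('n \<times> 'n) cmat"
  have zero: "f 0 = 0" "g 0 = 0"
    using assms(1)[of 0 0] assms(3)[of 0 0] by simp_all
  have F: "f (\<Sum>i\<in>A. h i) = (\<Sum>i\<in>A. f (h i)) \<and> g (\<Sum>i\<in>A. h i) = (\<Sum>i\<in>A. g (h i))"
    if "finite A" for A :: "('n \<times> 'n) set" and h
    using that by (induction A rule: finite_induct) (simp_all add: assms zero)
  let ?s = "\<Sum>p\<in>UNIV. \<Sum>q\<in>UNIV.
    cscale (a $ p $ q) (munit (fst p) (fst q) \<otimes>\<^sub>m munit (snd p) (snd q))"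
  have "f ?s = g ?s"
    by (simp add: F assms)
  then show "f a = g a"
    by (simp only: tensor_decomposition[of a, symmetric])
qed

lemma madj_mult: "madj (a ** b) = madj b ** madj a"
  by (simp add: madj_def matrix_matrix_mult_def vec_eq_iff mult.commute)

lemma is_range_projection_unique:
  assumes p: "is_range_projection p h" and q: "is_range_projection q h"
  shows "p = q"
proof -
  have *: "p ** q = q" if p: "is_range_projection p h" and q: "is_range_projection q h" for p q
  proof -
    have "p *v (q *v v) = q *v v" for v
    proof -
      have "q *v v \<in> range (\<lambda>v. p *v v)"
        using p q unfolding is_range_projection_def by auto
      then obtain w where "q *v v = p *v w" by auto
      then show ?thesis
        using p unfolding is_range_projection_def by (simp add: matrix_vector_mul_assoc)
    qed
    then show ?thesis
      by (simp add: matrix_eq matrix_vector_mul_assoc)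
  qed
  have "q = madj (p ** q)"
    using *[OF p q] q by (simp add: is_range_projection_def)
  also have "\<dots> = q ** p"
    using p q by (simp add: madj_mult is_range_projection_def)
  also have "\<dots> = p"
    by (rule *[OF q p])
  finally show ?thesis by simp
qed

end

theory Submission
  imports Defs
begin

text \<open>
  Write \<open>D = P - Q\<close> and \<open>T = I - D\<^sup>2\<close>. Two observations carry the proof.

  The first is a perturbation principle. If \<open>h\<close> is positive with range projection \<open>R\<close>, then \<open>h\<close>
  dominates a positive multiple of \<open>R\<close>, so every self-adjoint \<open>b\<close> in the corner \<open>R M R\<close> is a
  direction in which \<open>h\<close> can be moved a little both ways without losing positivity. Hence, if \<open>h\<close>
  is an extreme point of a set of states, \<open>b\<close> must vanish as soon as the remaining constraints of
  that set are unaffected by adding multiples of \<open>b\<close> (\<open>extreme_point_no_direction\<close>). For the set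
  of all states the only other constraint is the trace, and one finds that a state is pure exactly
  when \<open>R\<close> has rank one (\<open>pure_state_iff_rank_one\<close>). The marginal condition says
  \<open>P(h) = Q(h) = 1\<close>, so at an extreme point of the marginal tracial states no nonzero \<open>b\<close> in the
  corner satisfies \<open>P(b) = Q(b) = 0\<close> (\<open>extreme_marginal_no_direction\<close>).

  The second is that a rank-one matrix of trace zero is never of the form
  \<open>x \<otimes> 1 + 1 \<otimes> y\<close> when \<open>n \<ge> 2\<close> (\<open>outer_tensor_sum_trivial\<close>); this is read off from
  the 2 by 2 minors.

  If \<open>h\<^sub>0\<close> is pure, the corner is the line spanned by \<open>h\<^sub>0\<close>. Since \<open>D(h\<^sub>0) = 1 - 1 = 0\<close>, the map \<open>T\<close>
  fixes the corner pointwise. Conversely, suppose that \<open>T\<close> preserves the corner and that \<open>R\<close> has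
  rank at least two. Choose nonzero orthogonal vectors \<open>u\<close>, \<open>v\<close> in the range of \<open>R\<close> and let
  \<open>a = u v\<^sup>*\<close>, a rank-one element of the corner with trace zero. Since \<open>P Q = Q P\<close> is the trace,
  \<open>P(T(a)) = Q(T(a)) = \<tau>(a) 1 = 0\<close>, and \<open>T(a)\<close> lies in the corner, so \<open>T(a) = 0\<close> by extremality.
  But then \<open>a = D(D(a))\<close> is of the form \<open>x \<otimes> 1 + 1 \<otimes> y\<close>, a contradiction.
\<close>

section \<open>The Hermitian form and rank-one matrices\<close>

text \<open>
  The Hermitian inner product, conjugate linear in the first argument. Its real part is the real
  inner product of the underlying real space, so norms, compactness and Cauchy-Schwarz are available
  for the latter, while \<open>csip\<close> records the complex structure.
\<close>

definition csip :: "complex^'m \<Rightarrow> complex^'m \<Rightarrow> complex"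
  where "csip v w = (\<Sum>i\<in>UNIV. cnj (v $ i) * w $ i)"

definition outer :: "complex^'m \<Rightarrow> complex^'m \<Rightarrow> 'm::finite cmat"
  where "outer u v = (\<chi> i j. u $ i * cnj (v $ j))"

lemma Re_csip: "Re (csip v w) = v \<bullet> w"
  by (simp add: csip_def inner_vec_def inner_complex_def)

lemma csip_add: "csip (u + v) w = csip u w + csip v w" "csip w (u + v) = csip w u + csip w v"
  by (simp_all add: csip_def sum.distrib algebra_simps)

lemma csip_diff: "csip (u - v) w = csip u w - csip v w" "csip w (u - v) = csip w u - csip w v"
  by (simp_all add: csip_def sum_subtractf algebra_simps)

lemma csip_scale: "csip (c *s v) w = cnj c * csip v w" "csip v (c *s w) = c * csip v w"
  by (simp_all add: csip_def sum_distrib_left algebra_simps)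

lemma csip_commute: "csip v w = cnj (csip w v)"
  by (simp add: csip_def mult.commute)

lemma csip_self: "csip v v = complex_of_real (v \<bullet> v)"
proof -
  have "Im (csip v v) = 0"
    using csip_commute[of v v] by (metis Im_complex_of_real Reals_cnj_iff of_real_Re)
  then show ?thesis
    by (simp add: complex_eq_iff Re_csip)
qed

lemma csip_adjoint: "csip v (a *v w) = csip (madj a *v v) w"
proof -
  have "csip v (a *v w) = (\<Sum>i\<in>UNIV. \<Sum>j\<in>UNIV. cnj (v $ i) * a $ i $ j * w $ j)"
    by (simp add: csip_def matrix_vector_mult_def sum_distrib_left mult.assoc)
  also have "\<dots> = (\<Sum>j\<in>UNIV. \<Sum>i\<in>UNIV. cnj (v $ i) * a $ i $ j * w $ j)"
    by (rule sum.swap)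
  also have "\<dots> = csip (madj a *v v) w"
    by (simp add: csip_def matrix_vector_mult_def madj_def sum_distrib_right sum_distrib_left mult_ac)
  finally show ?thesis .
qed

lemma inner_adjoint: "v \<bullet> (a *v w) = (madj a *v v) \<bullet> w"
  by (metis Re_csip csip_adjoint)

lemma madj_madj [simp]: "madj (madj a) = a"
  by (simp add: madj_def vec_eq_iff)

lemma madj_add: "madj (a + b) = madj a + madj b"
  by (simp add: madj_def vec_eq_iff)

lemma matrix_mul_add_rdistrib: "(a + b) ** (c :: 'm::finite cmat) = a ** c + b ** c"
  by (simp add: matrix_matrix_mult_def vec_eq_iff sum.distrib distrib_right)

lemma madj_scaleR: "madj (t *\<^sub>R a) = t *\<^sub>R madj a"
  by (simp add: madj_def vec_eq_iff)

lemma madj_outer: "madj (outer u v) = outer v u"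
  by (simp add: madj_def outer_def vec_eq_iff mult.commute)

lemma linear_matrix_vector: "linear (\<lambda>v. (a :: 'm::finite cmat) *v v)"
  by (rule linearI) (simp_all add: matrix_vector_mult_def vec_eq_iff sum.distrib
      distrib_left scaleR_sum_right)

lemma scaleR_matrix_vector: "(t *\<^sub>R (a :: 'm::finite cmat)) *v v = t *\<^sub>R (a *v v)"
  by (simp add: matrix_vector_mult_def vec_eq_iff scaleR_sum_right)

lemma outer_apply: "outer u v *v w = csip v w *s u"
  by (simp add: outer_def csip_def matrix_vector_mult_def vec_eq_iff sum_distrib_left sum_distrib_right mult_ac)

lemma mult_outer_mult: "a ** outer u v ** b = outer (a *v u) (madj b *v v)"
proof -
  have "(a ** outer u v ** b) *v w = outer (a *v u) (madj b *v v) *v w" for w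
    by (simp add: matrix_vector_mul_assoc[symmetric] outer_apply csip_adjoint[of v b]
        vector_scalar_commute)
  then show ?thesis
    by (simp add: matrix_eq)
qed

lemma trace_outer: "trace (outer u v) = csip v u"
  by (simp add: trace_def outer_def csip_def mult.commute)

text \<open>
  By polarisation, a complex quadratic form with real values comes from a self-adjoint matrix.
  Once self-adjointness is split off, positivity can be tested with the real inner product alone.
\<close>

lemma positive_mat_iff:
  "positive_mat a \<longleftrightarrow> madj a = a \<and> (\<forall>v. 0 \<le> v \<bullet> (a *v v))" (is "_ \<longleftrightarrow> ?R")
proof
  assume "positive_mat a"
  then have pos: "csip v (a *v v) \<in> \<real>\<^sub>\<ge>\<^sub>0" for v
    by (simp add: positive_mat_def csip_def)
  define d where "d = a - madj a"
  have d0: "csip v (d *v v) = 0" for v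
  proof -
    have "csip v (madj a *v v) = cnj (csip v (a *v v))"
      by (metis csip_adjoint csip_commute madj_madj)
    moreover have "cnj (csip v (a *v v)) = csip v (a *v v)"
      using pos[of v] by (metis Reals_cnj_iff nonneg_Reals_subset_Reals subsetD)
    ultimately show ?thesis
      by (simp add: d_def csip_diff matrix_vector_mult_diff_rdistrib)
  qed
  \<comment> \<open>Polarisation: replacing \<open>w\<close> by \<open>\<i> w\<close> changes the sign of one of the two mixed terms only.\<close>
  have 1: "csip v (d *v w) + csip w (d *v v) = 0" for v w
    using d0[of "v + w"] d0[of v] d0[of w]
    by (simp add: csip_add matrix_vector_right_distrib add.commute)
  have "csip v (d *v w) = 0" for v w
    using 1[of v w] 1[of v "\<i> *s w"]
    by (simp add: csip_scale vector_scalar_commute)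
  then have "d *v w = 0" for w
    by (metis csip_self inner_eq_zero_iff of_real_eq_0_iff)
  then have "d = 0"
    by (simp add: matrix_eq)
  moreover have "0 \<le> v \<bullet> (a *v v)" for v
    using pos[of v] by (simp add: complex_nonneg_Reals_iff Re_csip)
  ultimately show ?R
    by (simp add: d_def)
next
  assume R: ?R
  have "csip v (a *v v) \<in> \<real>\<^sub>\<ge>\<^sub>0" for v
  proof -
    have "csip v (a *v v) = cnj (csip v (a *v v))"
      using R by (metis csip_adjoint csip_commute)
    then have "csip v (a *v v) \<in> \<real>"
      by (simp add: Reals_cnj_iff)
    then show ?thesis
      using R by (simp add: complex_nonneg_Reals_iff Re_csip complex_is_Real_iff)
  qed
  then show "positive_mat a"
    by (simp add: positive_mat_def csip_def)
qed

text \<open>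
  If \<open>a v \<noteq> 0\<close>, moving \<open>v\<close> slightly in the direction \<open>- a v\<close> would make the quadratic form
  negative.
\<close>

lemma positive_mat_null:
  assumes "positive_mat a" "v \<bullet> (a *v v) = 0"
  shows "a *v v = 0"
proof (rule ccontr)
  assume ne: "a *v v \<noteq> 0"
  have sa: "madj a = a" and pos: "0 \<le> x \<bullet> (a *v x)" for x
    using assms(1) by (auto simp: positive_mat_iff)
  define w where "w = a *v v"
  define q where "q = w \<bullet> (a *v w)"
  interpret L: linear "\<lambda>x. a *v x" by (rule linear_matrix_vector)
  have "w \<bullet> w > 0" using ne by (simp add: w_def)
  have "q \<ge> 0" using pos by (simp add: q_def)
  \<comment> \<open>Small enough that the term of second order in \<open>t\<close> does not compensate the first-order one;
    the 1 covers the case \<open>q = 0\<close>.\<close>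
  define t where "t = w \<bullet> w / (q + 1)"
  have "t > 0" using \<open>w \<bullet> w > 0\<close> \<open>q \<ge> 0\<close> by (simp add: t_def)
  have vw: "v \<bullet> (a *v w) = w \<bullet> w"
    by (metis inner_adjoint sa w_def)
  have "0 \<le> (v - t *\<^sub>R w) \<bullet> (a *v (v - t *\<^sub>R w))" by (rule pos)
  also have "\<dots> = t * (t * q - 2 * (w \<bullet> w))"
    using assms(2) vw
    by (simp add: L.diff L.scaleR inner_diff_left inner_diff_right q_def w_def[symmetric] algebra_simps)
  finally have "0 \<le> t * q - 2 * (w \<bullet> w)"
    using \<open>t > 0\<close> by (simp add: zero_le_mult_iff)
  moreover have "t * q \<le> w \<bullet> w"
    using \<open>q \<ge> 0\<close> \<open>w \<bullet> w > 0\<close> by (simp add: t_def field_simps)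
  ultimately show False using \<open>w \<bullet> w > 0\<close> by linarith
qed

section \<open>Range projections and corners\<close>

lemma corner_iff:
  assumes "p ** p = p"
  shows "a \<in> corner p \<longleftrightarrow> p ** a ** p = a"
  unfolding corner_def using assms by (auto simp: matrix_mul_assoc) (metis matrix_mul_assoc)+

text \<open>
  The second equation is the adjoint of the first, which is where self-adjointness of \<open>h\<close> enters.
\<close>

lemma range_projection_fixes:
  assumes "positive_mat h" "is_range_projection R h"
  shows "R ** h = h" "h ** R = h"
proof -
  have R: "R ** R = R" "madj R = R" "range (\<lambda>v. R *v v) = range (\<lambda>v. h *v v)"
    using assms(2) by (auto simp: is_range_projection_def)
  have "R *v (h *v v) = h *v v" for v
  proof -
    have "h *v v \<in> range (\<lambda>v. R *v v)" using R(3) by auto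
    then obtain w where "h *v v = R *v w" by auto
    then show ?thesis using R(1) by (simp add: matrix_vector_mul_assoc)
  qed
  then show "R ** h = h"
    by (simp add: matrix_eq matrix_vector_mul_assoc)
  then show "h ** R = h"
    using R(2) assms(1) by (metis madj_mult positive_mat_iff)
qed

text \<open>
  The quadratic form of \<open>h\<close> is strictly positive on the unit sphere of the range, because the range
  and the kernel of a self-adjoint matrix are orthogonal. By compactness it attains a positive
  minimum \<open>\<delta>\<close> there; in operator terms \<open>\<delta> R \<le> h\<close>.
\<close>

lemma bounded_below_on_range:
  assumes h: "positive_mat h" and R: "is_range_projection R h"
  obtains \<delta> where "\<delta> > 0" "\<And>v. \<delta> * (norm (R *v v))\<^sup>2 \<le> v \<bullet> (h *v v)"
proof -
  have RR: "R ** R = R" "madj R = R" "range (\<lambda>v. R *v v) = range (\<lambda>v. h *v v)"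
    using R by (auto simp: is_range_projection_def)
  have sa: "madj h = h" and pos: "0 \<le> x \<bullet> (h *v x)" for x
    using h by (auto simp: positive_mat_iff)
  interpret H: linear "\<lambda>x. h *v x" by (rule linear_matrix_vector)
  have cont: "continuous_on A (\<lambda>x. m *v x)" for A and m :: "'a cmat"
    using linear_matrix_vector[of m] by (simp add: linear_continuous_on linear_conv_bounded_linear)
  define K where "K = {v. R *v v = v} \<inter> sphere 0 1"
  have "closed {v. R *v v = v}"
    by (intro closed_Collect_eq cont continuous_intros)
  then have K: "compact K"
    by (simp add: K_def closed_Int_compact)
  have reduce: "v \<bullet> (h *v v) = (R *v v) \<bullet> (h *v (R *v v))" for v
  proof -
    have "h *v v = R *v (h *v (R *v v))"
      using range_projection_fixes[OF h R] by (simp add: matrix_vector_mul_assoc)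
    then show ?thesis
      using RR(2) by (metis inner_adjoint)
  qed
  \<comment> \<open>The sphere is empty when \<open>h = 0\<close>, and then any \<open>\<delta>\<close> will do.\<close>
  have "\<exists>\<delta>>0. \<forall>v\<in>K. \<delta> \<le> v \<bullet> (h *v v)"
  proof (cases "K = {}")
    case True
    then show ?thesis by (intro exI[of _ 1]) auto
  next
    case False
    have "continuous_on K (\<lambda>v. v \<bullet> (h *v v))"
      by (intro continuous_intros cont)
    then obtain v where v: "v \<in> K" "\<And>w. w \<in> K \<Longrightarrow> v \<bullet> (h *v v) \<le> w \<bullet> (h *v w)"
      using continuous_attains_inf[OF K False] by blast
    have "v \<bullet> (h *v v) \<noteq> 0"
    proof
      assume "v \<bullet> (h *v v) = 0"
      then have "h *v v = 0" using h by (rule positive_mat_null[rotated])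
      have "v \<in> range (\<lambda>v. R *v v)" using v(1) unfolding K_def by (auto intro: sym)
      then obtain w where "v = h *v w" using RR(3) by auto
      then have "v \<bullet> v = (h *v v) \<bullet> w" using inner_adjoint[of v h w] sa by simp
      then have "v = 0" using \<open>h *v v = 0\<close> by simp
      then show False using v(1) by (simp add: K_def)
    qed
    then have "v \<bullet> (h *v v) > 0" using pos[of v] by simp
    then show ?thesis using v(2) by blast
  qed
  then obtain \<delta> where \<delta>: "\<delta> > 0" "\<And>v. v \<in> K \<Longrightarrow> \<delta> \<le> v \<bullet> (h *v v)" by blast
  have "\<delta> * (norm (R *v v))\<^sup>2 \<le> v \<bullet> (h *v v)" for v
  proof (cases "R *v v = 0")
    case True
    then show ?thesis using pos[of v] by simp
  next
    case False
    define r where "r = norm (R *v v)"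
    have "r > 0" using False by (simp add: r_def)
    interpret LR: linear "\<lambda>x. R *v x" by (rule linear_matrix_vector)
    define w where "w = (1 / r) *\<^sub>R (R *v v)"
    have "w \<in> K"
      using \<open>r > 0\<close> RR(1) by (simp add: K_def w_def LR.scaleR matrix_vector_mul_assoc r_def[symmetric])
    then have "\<delta> \<le> w \<bullet> (h *v w)" by (rule \<delta>)
    also have "\<dots> = (v \<bullet> (h *v v)) / r\<^sup>2"
      by (simp add: w_def H.scaleR reduce[of v] power2_eq_square)
    finally show ?thesis
      using \<open>r > 0\<close> by (simp add: r_def[symmetric] field_simps)
  qed
  with \<delta>(1) that show ?thesis by blast
qed

text \<open>
  A self-adjoint \<open>b\<close> in the corner satisfies \<open>- C R \<le> b \<le> C R\<close> for some \<open>C\<close>, and \<open>\<delta> R \<le> h\<close>;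
  so \<open>\<epsilon> = \<delta> / C\<close> works.
\<close>

lemma positive_perturbation:
  assumes h: "positive_mat h" and R: "is_range_projection R h"
    and b: "b \<in> corner R" "madj b = b"
  obtains \<epsilon> :: real where "\<epsilon> > 0" "positive_mat (h + \<epsilon> *\<^sub>R b)" "positive_mat (h - \<epsilon> *\<^sub>R b)"
proof -
  have RR: "R ** R = R" "madj R = R"
    using R by (auto simp: is_range_projection_def)
  obtain \<delta> where \<delta>: "\<delta> > 0" "\<And>v. \<delta> * (norm (R *v v))\<^sup>2 \<le> v \<bullet> (h *v v)"
    using bounded_below_on_range[OF h R] by blast
  have "bounded_linear (\<lambda>v. b *v v)"
    using linear_matrix_vector[of b] by (simp add: linear_conv_bounded_linear)
  then obtain C where C: "C > 0" "\<And>v. norm (b *v v) \<le> norm v * C"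
    using bounded_linear.pos_bounded by blast
  have bound: "\<bar>v \<bullet> (b *v v)\<bar> \<le> C * (norm (R *v v))\<^sup>2" for v
  proof -
    have "b *v v = R *v (b *v (R *v v))"
      using b(1) RR(1) by (simp add: corner_iff matrix_vector_mul_assoc matrix_mul_assoc)
    then have "v \<bullet> (b *v v) = (R *v v) \<bullet> (b *v (R *v v))"
      using RR(2) by (metis inner_adjoint)
    also have "\<bar>\<dots>\<bar> \<le> norm (R *v v) * norm (b *v (R *v v))"
      by (rule Cauchy_Schwarz_ineq2)
    also have "\<dots> \<le> norm (R *v v) * (norm (R *v v) * C)"
      by (intro mult_left_mono C) simp
    finally show ?thesis by (simp add: power2_eq_square mult_ac)
  qed
  define \<epsilon> where "\<epsilon> = \<delta> / C"
  have "\<epsilon> > 0" using \<delta> C by (simp add: \<epsilon>_def)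
  have small: "\<epsilon> * \<bar>v \<bullet> (b *v v)\<bar> \<le> v \<bullet> (h *v v)" for v
  proof -
    have "\<epsilon> * \<bar>v \<bullet> (b *v v)\<bar> \<le> \<epsilon> * (C * (norm (R *v v))\<^sup>2)"
      using bound \<open>\<epsilon> > 0\<close> by (intro mult_left_mono) auto
    also have "\<dots> = \<delta> * (norm (R *v v))\<^sup>2" using C by (simp add: \<epsilon>_def)
    finally show ?thesis using \<delta>(2)[of v] by linarith
  qed
  have "positive_mat (h + s *\<^sub>R b)" if "\<bar>s\<bar> = \<epsilon>" for s
  proof -
    have "0 \<le> v \<bullet> ((h + s *\<^sub>R b) *v v)" for v
    proof -
      have "\<bar>s * (v \<bullet> (b *v v))\<bar> \<le> v \<bullet> (h *v v)"
        using small[of v] that by (simp add: abs_mult)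
      then show ?thesis
        by (simp add: matrix_vector_mult_add_rdistrib scaleR_matrix_vector inner_add_right)
    qed
    then show ?thesis
      using h b(2) by (simp add: positive_mat_iff madj_add madj_scaleR)
  qed
  from this[of \<epsilon>] this[of "-\<epsilon>"] \<open>\<epsilon> > 0\<close> that[of \<epsilon>] show ?thesis by simp
qed

text \<open>
  Otherwise \<open>h\<close> would be the midpoint of the distinct points \<open>h + \<epsilon> b\<close> and \<open>h - \<epsilon> b\<close> of \<open>S\<close>. The set
  \<open>S\<close> is left open so that the argument serves both the set of all states and the set of marginal
  tracial states.
\<close>

lemma extreme_point_no_direction:
  assumes ext: "h extreme_point_of S" and h: "positive_mat h" and R: "is_range_projection R h"
    and b: "b \<in> corner R" "madj b = b"
    and stay: "\<And>t::real. positive_mat (h + t *\<^sub>R b) \<Longrightarrow> h + t *\<^sub>R b \<in> S"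
  shows "b = 0"
proof (rule ccontr)
  assume "b \<noteq> 0"
  obtain \<epsilon> :: real where \<epsilon>: "\<epsilon> > 0" "positive_mat (h + \<epsilon> *\<^sub>R b)" "positive_mat (h - \<epsilon> *\<^sub>R b)"
    using positive_perturbation[OF h R b] by blast
  define x where "x = h + \<epsilon> *\<^sub>R b"
  define y where "y = h - \<epsilon> *\<^sub>R b"
  have "x \<in> S" "y \<in> S"
    using stay[of \<epsilon>] stay[of "-\<epsilon>"] \<epsilon> by (simp_all add: x_def y_def)
  moreover have "h = midpoint x y"
    by (simp add: midpoint_def x_def y_def scaleR_2[symmetric])
  moreover have "x \<noteq> y"
  proof
    assume "x = y"
    then have "(2 * \<epsilon>) *\<^sub>R b = 0" by (simp add: x_def y_def scaleR_2 flip: scaleR_scaleR)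
    then show False using \<open>b \<noteq> 0\<close> \<epsilon> by simp
  qed
  ultimately show False
    using ext midpoint_in_open_segment[of x y] unfolding extreme_point_of_def by blast
qed

text \<open>
  This replaces a notion of rank: the first alternative is rank at most one (with \<open>u = 0\<close> for the
  zero projection), the second rank at least two. If no vector of the range is orthogonal to a unit
  vector \<open>u\<close> of the range, then subtracting from \<open>R x\<close> its component along \<open>u\<close> leaves nothing.
\<close>

lemma rank_one_or_orthogonal_pair:
  assumes RR: "R ** R = R" "madj R = R"
  obtains u where "R = outer u u"
  | u v where "u \<noteq> 0" "v \<noteq> 0" "csip v u = 0" "R *v u = u" "R *v v = v"
proof (cases "R = 0")
  case True
  then have "R = outer 0 0" by (simp add: outer_def vec_eq_iff)
  then show ?thesis by (rule that)
next
  case False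
  then obtain w where w: "R *v w \<noteq> 0" by (auto simp: matrix_eq)
  interpret LR: linear "\<lambda>x. R *v x" by (rule linear_matrix_vector)
  define u where "u = (1 / norm (R *v w)) *\<^sub>R (R *v w)"
  have Ru: "R *v u = u" using RR(1) by (simp add: u_def LR.scaleR matrix_vector_mul_assoc)
  have "norm u = 1" using w by (simp add: u_def)
  then have uu: "csip u u = 1" by (simp add: csip_self norm_eq_1)
  show ?thesis
  proof (cases "\<forall>v. R *v v = v \<longrightarrow> csip v u = 0 \<longrightarrow> v = 0")
    case True
    have "R *v x = outer u u *v x" for x
    proof -
      define c where "c = csip u x"
      define z where "z = R *v x - c *s u"
      have "csip u (R *v x) = c"
        using RR(2) Ru by (simp add: csip_adjoint c_def)
      then have "csip u z = 0" by (simp add: z_def csip_diff csip_scale uu)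
      then have "csip z u = 0" by (metis csip_commute complex_cnj_zero)
      moreover have "R *v z = z"
        using RR(1) Ru by (simp add: z_def LR.diff matrix_vector_mul_assoc vector_scalar_commute)
      ultimately have "z = 0" using True by blast
      then show ?thesis by (simp add: z_def outer_apply c_def)
    qed
    then have "R = outer u u" by (simp add: matrix_eq)
    then show ?thesis by (rule that)
  next
    case False
    then obtain v where "R *v v = v" "csip v u = 0" "v \<noteq> 0" by blast
    moreover have "u \<noteq> 0" using \<open>norm u = 1\<close> by auto
    ultimately show ?thesis using that(2)[of u v] Ru by blast
  qed
qed

section \<open>Pure states\<close>

lemma corner_outer:
  assumes "a \<in> corner (outer u u)"
  obtains c where "a = cscale c (outer u u)"
proof -
  obtain b where b: "a = outer u u ** b ** outer u u"
    using assms by (auto simp: corner_def)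
  have "a *v w = cscale (csip u (b *v u)) (outer u u) *v w" for w
  proof -
    have "cscale c m *v w = c *s (m *v w)" for c and m :: "'a cmat"
      by (simp add: cscale_def matrix_vector_mult_def vec_eq_iff sum_distrib_left mult_ac)
    then show ?thesis
      by (simp add: b matrix_vector_mul_assoc[symmetric] outer_apply csip_scale
          vector_scalar_commute mult_ac)
  qed
  then show ?thesis using that by (metis matrix_eq)
qed

lemma ntrace_cscale: "ntrace (cscale c a) = c * ntrace a"
  by (simp add: ntrace_def trace_def cscale_def sum_distrib_left)

lemma ntrace_add: "ntrace (a + b) = ntrace a + ntrace b"
  by (simp add: ntrace_def trace_def sum.distrib add_divide_distrib)

lemma scaleR_eq_cscale: "t *\<^sub>R a = cscale (complex_of_real t) a"
  unfolding cscale_def vec_eq_iff vector_scaleR_component by (simp add: scaleR_conv_of_real)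

lemma state_in_corner_outer_unique:
  assumes "a \<in> states" "b \<in> states" "a \<in> corner (outer u u)" "b \<in> corner (outer u u)"
  shows "a = b"
proof -
  obtain c where c: "a = cscale c (outer u u)" using corner_outer assms(3) by blast
  obtain d where d: "b = cscale d (outer u u)" using corner_outer assms(4) by blast
  have "c * ntrace (outer u u) = 1" "d * ntrace (outer u u) = 1"
    using assms(1,2) c d by (auto simp: states_def ntrace_cscale)
  then have "c = d" by (metis mult_cancel_right mult_zero_right zero_neq_one)
  then show ?thesis using c d by simp
qed

text \<open>
  The hypothesis holds in particular when \<open>h\<close> is a convex combination of \<open>a\<close> and another positive
  matrix with positive weights: \<open>a\<close> then vanishes on the kernel of \<open>h\<close>, which is the range of
  \<open>1 - R\<close>.
\<close>

lemma dominated_in_corner: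
  assumes h: "positive_mat h" and R: "is_range_projection R h" and a: "positive_mat a"
    and dom: "\<And>v. v \<bullet> (h *v v) = 0 \<Longrightarrow> v \<bullet> (a *v v) = 0"
  shows "a \<in> corner R"
proof -
  have RR: "R ** R = R" "madj R = R"
    using R by (auto simp: is_range_projection_def)
  have "a *v (v - R *v v) = 0" for v
  proof -
    have "h *v (v - R *v v) = 0"
      using range_projection_fixes[OF h R]
      by (simp add: matrix_vector_mult_diff_distrib matrix_vector_mul_assoc)
    then show ?thesis using positive_mat_null[OF a] dom by simp
  qed
  then have aR: "a ** R = a"
    by (simp add: matrix_eq matrix_vector_mult_diff_distrib matrix_vector_mul_assoc)
  then have "R ** a = a"
    using RR(2) a by (metis madj_mult positive_mat_iff)
  then show ?thesis using aR RR(1) by (simp add: corner_iff)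
qed

text \<open>
  Given orthogonal nonzero \<open>u\<close>, \<open>v\<close> in the range of \<open>R\<close>, the self-adjoint trace-zero matrix
  \<open>u v\<^sup>* + v u\<^sup>*\<close> is a direction in which the density \<open>h\<close> can be moved within the states. If instead
  \<open>R\<close> has rank one, any two states whose segment contains \<open>h\<close> lie in the corner of \<open>R\<close>, which is a
  line and contains only one matrix of normalised trace 1.
\<close>

lemma pure_state_iff_rank_one:
  assumes h: "h \<in> states" and R: "is_range_projection R h"
  shows "pure_state h \<longleftrightarrow> (\<exists>u. R = outer u u)"
proof
  have pos: "positive_mat h" using h by (simp add: states_def)
  have RR: "R ** R = R" "madj R = R"
    using R by (auto simp: is_range_projection_def)
  {
    assume "pure_state h"
    then have ext: "h extreme_point_of states" by (simp add: pure_state_def)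
    show "\<exists>u. R = outer u u"
    proof (cases rule: rank_one_or_orthogonal_pair[OF RR])
      case (1 u)
      then show ?thesis by blast
    next
      case (2 u v)
      define b where "b = outer u v + outer v u"
      have "b \<in> corner R"
        using 2 RR by (simp add: corner_iff b_def matrix_add_ldistrib matrix_mul_add_rdistrib mult_outer_mult)
      moreover have "madj b = b"
        by (simp add: b_def madj_add madj_outer add.commute)
      moreover have "h + t *\<^sub>R b \<in> states" if "positive_mat (h + t *\<^sub>R b)" for t :: real
      proof -
        have "csip u v = 0" using 2 by (metis csip_commute complex_cnj_zero)
        then have "ntrace b = 0"
          using 2 by (simp add: b_def ntrace_add) (simp add: ntrace_def trace_outer)
        then show ?thesis
          using that h by (simp add: states_def ntrace_add ntrace_cscale scaleR_eq_cscale)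
      qed
      ultimately have "b = 0"
        by (rule extreme_point_no_direction[OF ext pos R])
      moreover have "b *v v = csip v v *s u"
        using 2 by (simp add: b_def matrix_vector_mult_add_rdistrib outer_apply csip_commute[of u v])
      ultimately have "csip v v *s u = 0" by simp
      then show ?thesis
        using 2 by (simp add: csip_self)
    qed
  }
  {
    assume "\<exists>u. R = outer u u"
    then obtain u where u: "R = outer u u" ..
    have "h \<notin> open_segment a b" if ab: "a \<in> states" "b \<in> states" for a b
    proof
      assume "h \<in> open_segment a b"
      then obtain t where t: "0 < t" "t < 1" "h = (1 - t) *\<^sub>R a + t *\<^sub>R b" and "a \<noteq> b"
        by (auto simp: in_segment)
      have pa: "positive_mat a" and pb: "positive_mat b" using ab by (auto simp: states_def)
      have "v \<bullet> (a *v v) = 0 \<and> v \<bullet> (b *v v) = 0" if "v \<bullet> (h *v v) = 0" for v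
      proof -
        have "(1 - t) * (v \<bullet> (a *v v)) + t * (v \<bullet> (b *v v)) = 0"
          using that by (simp add: t matrix_vector_mult_add_rdistrib scaleR_matrix_vector inner_add_right)
        moreover have "(1 - t) * (v \<bullet> (a *v v)) \<ge> 0" "t * (v \<bullet> (b *v v)) \<ge> 0"
          using pa pb t by (auto simp: positive_mat_iff)
        ultimately have "(1 - t) * (v \<bullet> (a *v v)) = 0" "t * (v \<bullet> (b *v v)) = 0"
          by linarith+
        then show ?thesis using t by simp
      qed
      then have "a \<in> corner R" "b \<in> corner R"
        using dominated_in_corner[OF pos R] pa pb by blast+
      then show False
        using state_in_corner_outer_unique ab u \<open>a \<noteq> b\<close> by blast
    qed
    then show "pure_state h"
      using h by (simp add: pure_state_def extreme_point_of_def)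
  }
qed

section \<open>Partial traces and marginals\<close>

text \<open>
  Only the partial trace of \<open>h\<close> enters: evaluation on \<open>x \<otimes> 1\<close> is the trace pairing of \<open>x\<close> with it.
\<close>

lemma functional_of_left:
  fixes h :: "('n::finite \<times> 'n) cmat"
  shows "functional_of h (x \<otimes>\<^sub>m mat 1) =
    (\<Sum>i\<in>UNIV. \<Sum>j\<in>UNIV. x $ i $ j * (\<Sum>k\<in>UNIV. h $ (j, k) $ (i, k))) / (of_nat CARD('n))\<^sup>2"
proof -
  have "(\<Sum>p\<in>UNIV. \<Sum>q\<in>UNIV. x $ fst p $ fst q * mat 1 $ snd p $ snd q * h $ q $ p)
    = (\<Sum>i\<in>UNIV. \<Sum>k\<in>UNIV. \<Sum>j\<in>UNIV. \<Sum>l\<in>UNIV. x $ i $ j * mat 1 $ k $ l * h $ (j, l) $ (i, k))"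
    by (simp add: UNIV_Times_UNIV[symmetric] sum.cartesian_product' del: UNIV_Times_UNIV)
  also have "\<dots> = (\<Sum>i\<in>UNIV. \<Sum>k\<in>UNIV. \<Sum>j\<in>UNIV. x $ i $ j * h $ (j, k) $ (i, k))"
    by (simp add: mat_def if_distrib[of "\<lambda>x. _ * x"] if_distrib[of "\<lambda>x. x * _"] cong: if_cong)
  also have "\<dots> = (\<Sum>i\<in>UNIV. \<Sum>j\<in>UNIV. \<Sum>k\<in>UNIV. x $ i $ j * h $ (j, k) $ (i, k))"
    by (intro sum.cong refl sum.swap)
  finally show ?thesis
    by (simp add: functional_of_def ntrace_def trace_def matrix_matrix_mult_def tensor_def
        sum_distrib_left power2_eq_square)
qed

lemma functional_of_right:
  fixes h :: "('n::finite \<times> 'n) cmat"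
  shows "functional_of h (mat 1 \<otimes>\<^sub>m x) =
    (\<Sum>k\<in>UNIV. \<Sum>l\<in>UNIV. x $ k $ l * (\<Sum>i\<in>UNIV. h $ (i, l) $ (i, k))) / (of_nat CARD('n))\<^sup>2"
proof -
  have "(\<Sum>p\<in>UNIV. \<Sum>q\<in>UNIV. mat 1 $ fst p $ fst q * x $ snd p $ snd q * h $ q $ p)
    = (\<Sum>i\<in>UNIV. \<Sum>k\<in>UNIV. \<Sum>j\<in>UNIV. \<Sum>l\<in>UNIV. mat 1 $ i $ j * x $ k $ l * h $ (j, l) $ (i, k))"
    by (simp add: UNIV_Times_UNIV[symmetric] sum.cartesian_product' del: UNIV_Times_UNIV)
  also have "\<dots> = (\<Sum>i\<in>UNIV. \<Sum>k\<in>UNIV. \<Sum>l\<in>UNIV. \<Sum>j\<in>UNIV. mat 1 $ i $ j * x $ k $ l * h $ (j, l) $ (i, k))"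
    by (intro sum.cong refl sum.swap)
  also have "\<dots> = (\<Sum>i\<in>UNIV. \<Sum>k\<in>UNIV. \<Sum>l\<in>UNIV. x $ k $ l * h $ (i, l) $ (i, k))"
    by (simp add: mat_def if_distrib[of "\<lambda>x. _ * x"] if_distrib[of "\<lambda>x. x * _"] cong: if_cong)
  also have "\<dots> = (\<Sum>k\<in>UNIV. \<Sum>i\<in>UNIV. \<Sum>l\<in>UNIV. x $ k $ l * h $ (i, l) $ (i, k))"
    by (rule sum.swap)
  also have "\<dots> = (\<Sum>k\<in>UNIV. \<Sum>l\<in>UNIV. \<Sum>i\<in>UNIV. x $ k $ l * h $ (i, l) $ (i, k))"
    by (intro sum.cong refl sum.swap)
  finally show ?thesis
    by (simp add: functional_of_def ntrace_def trace_def matrix_matrix_mult_def tensor_def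
        sum_distrib_left power2_eq_square)
qed

text \<open>
  The trace pairing is nondegenerate, so the marginal condition on functionals fixes the two partial
  traces of the density. Testing against matrix units suffices.
\<close>

lemma marginal_tracial_states_eq:
  "(marginal_tracial_states :: ('n::finite \<times> 'n) cmat set) =
    {h \<in> states. cond_exp_left h = mat 1 \<and> cond_exp_right h = mat 1}"
proof -
  let ?n = "of_nat CARD('n) :: complex"
  have n: "?n \<noteq> 0" by simp
  have entry: "(\<Sum>i\<in>UNIV. \<Sum>j\<in>UNIV. munit c d $ i $ j * f i j) = f c d"
    for f :: "'n \<Rightarrow> 'n \<Rightarrow> complex" and c d
  proof -
    have "(\<Sum>i\<in>UNIV. \<Sum>j\<in>UNIV. munit c d $ i $ j * f i j)
      = (\<Sum>i\<in>UNIV. \<Sum>j\<in>UNIV. if i = c then if j = d then f i j else 0 else 0)"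
      by (intro sum.cong) (auto simp: munit_def)
    also have "\<dots> = (\<Sum>i\<in>UNIV. if i = c then f i d else 0)"
      by (intro sum.cong) auto
    finally show ?thesis by simp
  qed
  \<comment> \<open>The normalised trace, written as a pairing of the same shape as in \<open>functional_of_left\<close>, so that
    the coefficients can be compared.\<close>
  have tr: "ntrace x = (\<Sum>i\<in>UNIV. \<Sum>j\<in>UNIV. x $ i $ j * (if i = j then ?n else 0)) / ?n\<^sup>2"
    for x :: "'n cmat"
    by (simp add: ntrace_def trace_def power2_eq_square sum_distrib_right[symmetric]
        if_distrib[of "\<lambda>y. _ * y"] cong: if_cong)
  have pairing: "(\<forall>x::'n cmat. (\<Sum>i\<in>UNIV. \<Sum>j\<in>UNIV. x $ i $ j * g i j) / ?n\<^sup>2 = ntrace x)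
      \<longleftrightarrow> (\<forall>i j. g i j = (if i = j then ?n else 0))" for g :: "'n \<Rightarrow> 'n \<Rightarrow> complex"
  proof
    assume *: "\<forall>x::'n cmat. (\<Sum>i\<in>UNIV. \<Sum>j\<in>UNIV. x $ i $ j * g i j) / ?n\<^sup>2 = ntrace x"
    show "\<forall>i j. g i j = (if i = j then ?n else 0)"
    proof (intro allI)
      fix i j
      show "g i j = (if i = j then ?n else 0)"
        using *[rule_format, of "munit i j"] n unfolding tr entry by simp
    qed
  next
    assume "\<forall>i j. g i j = (if i = j then ?n else 0)"
    then show "\<forall>x::'n cmat. (\<Sum>i\<in>UNIV. \<Sum>j\<in>UNIV. x $ i $ j * g i j) / ?n\<^sup>2 = ntrace x"
      unfolding tr by simp
  qed
  have left: "cond_exp_left h = mat 1 \<longleftrightarrow>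
      (\<forall>i j. (\<Sum>k\<in>UNIV. h $ (j, k) $ (i, k)) = (if i = j then ?n else 0))" for h :: "('n \<times> 'n) cmat"
    using n by (auto simp: cond_exp_left_def tensor_def mat_def vec_eq_iff field_simps split: if_splits)
  have right: "cond_exp_right h = mat 1 \<longleftrightarrow>
      (\<forall>k l. (\<Sum>i\<in>UNIV. h $ (i, l) $ (i, k)) = (if k = l then ?n else 0))" for h :: "('n \<times> 'n) cmat"
    using n by (auto simp: cond_exp_right_def tensor_def mat_def vec_eq_iff field_simps split: if_splits)
  show ?thesis
    unfolding marginal_tracial_states_def functional_of_left functional_of_right all_conj_distrib
      pairing left right by simp
qed

lemma cond_exp_diff_linear:
  "cond_exp_diff (a + b) = cond_exp_diff a + cond_exp_diff b"
  "cond_exp_diff (a - b) = cond_exp_diff a - cond_exp_diff b"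
  "cond_exp_diff (cscale c a) = cscale c (cond_exp_diff a)"
proof -
  show add: "cond_exp_diff (a + b) = cond_exp_diff a + cond_exp_diff b" for a b
    by (simp add: cond_exp_diff_def cond_exp_left_linear cond_exp_right_linear)
  show "cond_exp_diff (a - b) = cond_exp_diff a - cond_exp_diff b"
    using add[of "a - b" b] by (simp add: algebra_simps)
  show "cond_exp_diff (cscale c a) = cscale c (cond_exp_diff a)"
    by (simp add: cond_exp_diff_def cond_exp_left_linear cond_exp_right_linear)
      (simp add: cscale_def vec_eq_iff right_diff_distrib)
qed

lemma cond_exp_diff_marginal:
  assumes "h \<in> marginal_tracial_states"
  shows "cond_exp_diff h = 0"
  using assms by (simp add: marginal_tracial_states_eq cond_exp_diff_def)

lemma ntrace_mat_one: "ntrace (mat 1 :: 'm::finite cmat) = 1"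
  by (simp add: ntrace_def trace_def mat_def)

lemma tensor_one_one: "mat 1 \<otimes>\<^sub>m mat 1 = mat 1"
  by (auto simp: tensor_def mat_def vec_eq_iff prod_eq_iff)

lemma ntrace_partial_left:
  fixes a :: "('n::finite \<times> 'n) cmat"
  shows "ntrace (\<chi> i j. (\<Sum>k\<in>UNIV. a $ (i, k) $ (j, k)) / of_nat CARD('n)) = ntrace a"
proof -
  have "trace a = (\<Sum>i\<in>UNIV. \<Sum>k\<in>UNIV. a $ (i, k) $ (i, k))"
    by (simp add: trace_def sum.cartesian_product)
  then show ?thesis
    by (simp add: ntrace_def trace_def sum_divide_distrib[symmetric])
qed

lemma ntrace_partial_right:
  fixes a :: "('n::finite \<times> 'n) cmat"
  shows "ntrace (\<chi> k l. (\<Sum>i\<in>UNIV. a $ (i, k) $ (i, l)) / of_nat CARD('n)) = ntrace a"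
proof -
  have "trace a = (\<Sum>i\<in>UNIV. \<Sum>k\<in>UNIV. a $ (i, k) $ (i, k))"
    by (simp add: trace_def sum.cartesian_product)
  also have "\<dots> = (\<Sum>k\<in>UNIV. \<Sum>i\<in>UNIV. a $ (i, k) $ (i, k))"
    by (rule sum.swap)
  finally show ?thesis
    by (simp add: ntrace_def trace_def sum_divide_distrib[symmetric])
qed

lemma cscale_one: "cscale 1 a = a"
  by (simp add: cscale_def vec_eq_iff)

lemma cscale_zero: "cscale 0 a = 0" "cscale c 0 = 0"
  by (simp_all add: cscale_def vec_eq_iff)

lemma cond_exp_compose:
  "cond_exp_left (cond_exp_left a) = cond_exp_left a"
  "cond_exp_left (cond_exp_right a) = cscale (ntrace a) (mat 1)"
  "cond_exp_right (cond_exp_right a) = cond_exp_right a"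
  "cond_exp_right (cond_exp_left a) = cscale (ntrace a) (mat 1)"
proof -
  show "cond_exp_left (cond_exp_left a) = cond_exp_left a"
    unfolding cond_exp_left_def[of a] cond_exp_left_tensor ntrace_mat_one cscale_one ..
  show "cond_exp_left (cond_exp_right a) = cscale (ntrace a) (mat 1)"
    unfolding cond_exp_right_def cond_exp_left_tensor ntrace_partial_right tensor_one_one ..
  show "cond_exp_right (cond_exp_right a) = cond_exp_right a"
    unfolding cond_exp_right_def[of a] cond_exp_right_tensor ntrace_mat_one cscale_one ..
  show "cond_exp_right (cond_exp_left a) = cscale (ntrace a) (mat 1)"
    unfolding cond_exp_left_def cond_exp_right_tensor ntrace_partial_left tensor_one_one ..
qed

lemma cond_exp_minus:
  "cond_exp_left (a - b) = cond_exp_left a - cond_exp_left b"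
  "cond_exp_right (a - b) = cond_exp_right a - cond_exp_right b"
  using cond_exp_left_linear(1)[of "a - b" b] cond_exp_right_linear(1)[of "a - b" b]
  by (simp_all add: algebra_simps)

text \<open>
  Up to sign, \<open>D = P - Q\<close> acts under either expectation as that expectation, corrected by the trace.
  On matrices of trace zero this gives \<open>P D\<^sup>2 = P\<close> and \<open>Q D\<^sup>2 = Q\<close>, so both expectations annihilate
  the values of \<open>I - D\<^sup>2\<close> there.
\<close>

lemma cond_exp_of_diff:
  "cond_exp_left (cond_exp_diff a) = cond_exp_left a - cscale (ntrace a) (mat 1)"
  "cond_exp_right (cond_exp_diff a) = cscale (ntrace a) (mat 1) - cond_exp_right a"
  by (simp_all add: cond_exp_diff_def cond_exp_minus cond_exp_compose)

lemma ntrace_cond_exp: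
  "ntrace (cond_exp_left a) = ntrace a"
  "ntrace (cond_exp_right a) = ntrace a"
proof -
  have *: "c = d" if "cscale c (mat 1) = (cscale d (mat 1) :: 'm::finite cmat)" for c d
    using arg_cong[OF that, of ntrace] by (simp add: ntrace_cscale ntrace_mat_one)
  show "ntrace (cond_exp_left a) = ntrace a"
    using cond_exp_compose(4)[of "cond_exp_left a"] by (intro *[symmetric]) (simp add: cond_exp_compose)
  show "ntrace (cond_exp_right a) = ntrace a"
    using cond_exp_compose(2)[of "cond_exp_right a"] by (intro *[symmetric]) (simp add: cond_exp_compose)
qed

lemma ntrace_cond_exp_diff: "ntrace (cond_exp_diff a) = 0"
  using ntrace_add[of "cond_exp_diff a" "cond_exp_right a"]
  by (simp add: cond_exp_diff_def ntrace_cond_exp)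

lemma cond_exp_madj:
  "cond_exp_left (madj a) = madj (cond_exp_left a)"
  "cond_exp_right (madj a) = madj (cond_exp_right a)"
  by (auto simp: cond_exp_left_def cond_exp_right_def tensor_def madj_def mat_def vec_eq_iff)

text \<open>
  Suppose \<open>x\<close> has an entry \<open>x\<^sub>i\<^sub>j\<close> off the diagonal and let \<open>k \<noteq> l\<close>. The minor of
  \<open>x \<otimes> 1 + 1 \<otimes> y\<close> on the rows \<open>(i, k)\<close>, \<open>(i, l)\<close> and columns \<open>(j, k)\<close>, \<open>(j, l)\<close> is
  \<open>x\<^sub>i\<^sub>j\<^sup>2\<close>, and it vanishes for a rank-one matrix. So \<open>x\<close>, and likewise \<open>y\<close>, is diagonal. A diagonal
  matrix of rank at most one has at most one nonzero entry, and that entry is its trace.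
\<close>

lemma outer_tensor_sum_trivial:
  fixes u v :: "complex^('n::finite \<times> 'n)"
  assumes n: "CARD('n) \<ge> 2"
    and eq: "outer u v = x \<otimes>\<^sub>m mat 1 + mat 1 \<otimes>\<^sub>m y"
    and tr: "csip v u = 0"
  shows "outer u v = 0"
proof -
  define a where "a = outer u v"
  have minor: "a $ p $ q * a $ r $ s = a $ p $ s * a $ r $ q" for p q r s
    by (simp add: a_def outer_def)
  have entry: "a $ (i, k) $ (j, l) = x $ i $ j * of_bool (k = l) + of_bool (i = j) * y $ k $ l" for i j k l
    by (simp add: a_def eq tensor_def mat_def)
  have other: "\<exists>l. l \<noteq> k" for k :: 'n
  proof (rule ccontr)
    assume "\<nexists>l. l \<noteq> k"
    then have "(UNIV :: 'n set) = {k}" by auto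
    then have "CARD('n) = 1" by (metis card_1_singleton_iff One_nat_def)
    then show False using n by simp
  qed
  have x: "x $ i $ j = 0" if "i \<noteq> j" for i j
  proof -
    obtain k l :: 'n where "l \<noteq> k" using other by blast
    then show ?thesis
      using minor[of "(i, k)" "(j, k)" "(i, l)" "(j, l)"] that by (simp add: entry)
  qed
  have y: "y $ k $ l = 0" if "k \<noteq> l" for k l
  proof -
    obtain i j :: 'n where "j \<noteq> i" using other by blast
    then show ?thesis
      using minor[of "(i, k)" "(i, l)" "(j, k)" "(j, l)"] that by (simp add: entry)
  qed
  have off: "a $ p $ q = 0" if "p \<noteq> q" for p q
    using that by (cases p; cases q) (auto simp: entry x y)
  have "a $ p $ p = 0" for p
  proof (rule ccontr)
    assume p: "a $ p $ p \<noteq> 0"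
    have "a $ q $ q = 0" if "q \<noteq> p" for q
      using minor[of p p q q] off[of p q] that p by simp
    then have "trace a = (\<Sum>q\<in>UNIV. if q = p then a $ p $ p else 0)"
      unfolding trace_def by (intro sum.cong) auto
    then show False using p tr by (simp add: a_def trace_outer)
  qed
  then have "a = 0" using off by (auto simp: vec_eq_iff) metis
  then show ?thesis by (simp add: a_def)
qed

text \<open>
  The perturbation principle needs self-adjoint directions. The corner and the kernels of the two
  conditional expectations are complex subspaces closed under adjoints, so it applies to
  \<open>b + b\<^sup>*\<close> and \<open>\<i> b + (\<i> b)\<^sup>*\<close>, which together determine \<open>b\<close>.
\<close>

lemma extreme_marginal_no_direction:
  fixes h R :: "('n::finite \<times> 'n) cmat"
  assumes ext: "h extreme_point_of marginal_tracial_states" and R: "is_range_projection R h"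
    and b: "b \<in> corner R" and marg: "cond_exp_left b = 0" "cond_exp_right b = 0"
  shows "b = 0"
proof -
  have hG: "h \<in> states" "cond_exp_left h = mat 1" "cond_exp_right h = mat 1"
    using ext by (auto simp: extreme_point_of_def marginal_tracial_states_eq)
  then have pos: "positive_mat h" by (simp add: states_def)
  have RR: "R ** R = R" "madj R = R"
    using R by (auto simp: is_range_projection_def)
  have RbR: "R ** b ** R = b" using b RR by (simp add: corner_iff)
  then have RbR': "R ** madj b ** R = madj b"
    using RR(2) by (metis madj_mult matrix_mul_assoc)
  have sa: "c = 0" if c: "R ** c ** R = c" "madj c = c" "cond_exp_left c = 0" "cond_exp_right c = 0" for c
  proof (rule extreme_point_no_direction[OF ext pos R])
    show "c \<in> corner R" using c RR by (simp add: corner_iff)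
    show "madj c = c" by fact
    show "h + t *\<^sub>R c \<in> marginal_tracial_states" if "positive_mat (h + t *\<^sub>R c)" for t :: real
    proof -
      have "ntrace c = 0"
        using c(3) ntrace_cond_exp(1)[of c] by (simp add: ntrace_def trace_def)
      then show ?thesis
        using that hG c unfolding scaleR_eq_cscale
        by (simp add: marginal_tracial_states_eq states_def ntrace_add ntrace_cscale
            cond_exp_left_linear cond_exp_right_linear cscale_zero)
    qed
  qed
  have z: "madj 0 = 0" by (simp add: madj_def vec_eq_iff)
  have mi: "R ** cscale \<i> c ** R = cscale \<i> (R ** c ** R)" for c
    by (simp add: cscale_def matrix_matrix_mult_def vec_eq_iff sum_distrib_left sum_distrib_right mult_ac)
  define c where "c = b + madj b"
  define d where "d = cscale \<i> b + madj (cscale \<i> b)"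
  have "c = 0"
    unfolding c_def
    by (rule sa) (simp_all add: RbR RbR' matrix_add_ldistrib matrix_mul_add_rdistrib madj_add add.commute
        cond_exp_left_linear cond_exp_right_linear cond_exp_madj marg z cscale_zero)
  moreover have "d = 0"
    unfolding d_def
  proof (rule sa)
    have "R ** madj (cscale \<i> b) ** R = madj (cscale \<i> b)"
      using mi[of b] RbR RR(2) by (metis madj_mult matrix_mul_assoc)
    then show "R ** (cscale \<i> b + madj (cscale \<i> b)) ** R = cscale \<i> b + madj (cscale \<i> b)"
      by (simp add: mi RbR matrix_add_ldistrib matrix_mul_add_rdistrib)
  qed (simp_all add: madj_add add.commute
        cond_exp_left_linear cond_exp_right_linear cond_exp_madj marg z cscale_zero)
  moreover have "2 * b $ i $ j = c $ i $ j - \<i> * d $ i $ j" for i j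
    by (simp add: c_def d_def madj_def cscale_def algebra_simps)
  ultimately have "b $ i $ j = 0" for i j by simp
  then show ?thesis by (simp add: vec_eq_iff)
qed

theorem theorem2p9:
  fixes h\<^sub>0 R :: "('n::finite \<times> 'n) cmat"
  assumes "CARD('n) \<ge> 2"
    and "h\<^sub>0 extreme_point_of marginal_tracial_states"
    and "is_range_projection R h\<^sub>0"
  shows "pure_state h\<^sub>0 \<longleftrightarrow>
    (\<lambda>a. a - (cond_exp_diff \<circ> cond_exp_diff) a) ` corner R \<subseteq> corner R"
proof
  have G: "h\<^sub>0 \<in> marginal_tracial_states"
    using assms(2) by (simp add: extreme_point_of_def)
  then have st: "h\<^sub>0 \<in> states" by (simp add: marginal_tracial_states_def)
  then have pos: "positive_mat h\<^sub>0" and tr: "ntrace h\<^sub>0 = 1" by (simp_all add: states_def)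
  have RR: "R ** R = R" "madj R = R"
    using assms(3) by (auto simp: is_range_projection_def)
  note pure = pure_state_iff_rank_one[OF st assms(3)]
  {
    assume "pure_state h\<^sub>0"
    then obtain u where u: "R = outer u u" using pure by blast
    have "h\<^sub>0 \<in> corner R"
      using range_projection_fixes[OF pos assms(3)] RR by (simp add: corner_iff)
    then obtain c where c: "h\<^sub>0 = cscale c R" using corner_outer u by metis
    have "c \<noteq> 0" using tr c by (auto simp: ntrace_cscale)
    then have "R = cscale (1 / c) h\<^sub>0" by (simp add: c cscale_def vec_eq_iff)
    then have "cond_exp_diff R = cscale (1 / c) (cond_exp_diff h\<^sub>0)"
      by (simp only: cond_exp_diff_linear)
    then have DR: "cond_exp_diff R = 0"
      by (simp add: cond_exp_diff_marginal[OF G] cscale_zero)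
    have D0: "cond_exp_diff (0 :: ('n \<times> 'n) cmat) = 0"
      using cond_exp_diff_linear(2)[of 0 0] by simp
    have "cond_exp_diff (cond_exp_diff a) = 0" if a: "a \<in> corner R" for a
    proof -
      obtain e where "a = cscale e R" using corner_outer[OF a[unfolded u]] u by blast
      then have "cond_exp_diff a = 0" by (simp add: cond_exp_diff_linear DR cscale_zero)
      then show ?thesis by (simp add: D0)
    qed
    then show "(\<lambda>a. a - (cond_exp_diff \<circ> cond_exp_diff) a) ` corner R \<subseteq> corner R" by auto
  }
  {
    assume inv: "(\<lambda>a. a - (cond_exp_diff \<circ> cond_exp_diff) a) ` corner R \<subseteq> corner R"
    have "\<exists>u. R = outer u u"
    proof (cases rule: rank_one_or_orthogonal_pair[OF RR])
      case (1 u)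
      then show ?thesis by blast
    next
      case (2 u v)
      define a where "a = outer u v"
      define b where "b = a - cond_exp_diff (cond_exp_diff a)"
      have "a \<in> corner R" using 2 RR by (simp add: a_def corner_iff mult_outer_mult)
      then have "b \<in> corner R" using inv by (auto simp: b_def)
      moreover have "ntrace a = 0" using 2 by (simp add: a_def ntrace_def trace_outer)
      ultimately have "cond_exp_left b = 0" "cond_exp_right b = 0"
        by (simp_all add: b_def cond_exp_minus cond_exp_of_diff ntrace_cond_exp_diff cscale_zero)
      with \<open>b \<in> corner R\<close> have "b = 0"
        by (rule extreme_marginal_no_direction[OF assms(2,3)])
      then have "outer u v = cond_exp_diff (cond_exp_diff a)" by (simp add: a_def b_def)
      then obtain x y where "outer u v = x \<otimes>\<^sub>m mat 1 - mat 1 \<otimes>\<^sub>m y"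
        unfolding cond_exp_diff_def[of "cond_exp_diff a"] cond_exp_left_def cond_exp_right_def
        by (rule that)
      then have "outer u v = x \<otimes>\<^sub>m mat 1 + mat 1 \<otimes>\<^sub>m (- y)"
        by (simp add: tensor_def vec_eq_iff)
      then have "outer u v = 0"
        using outer_tensor_sum_trivial[OF assms(1)] 2 by blast
      then have "csip v v *s u = 0" using outer_apply[of u v v] by simp
      then show ?thesis using 2 by (simp add: csip_self)
    qed
    then show "pure_state h\<^sub>0" using pure by blast
  }
qed

end
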